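(* Let $S\subset\mathbb{R}^d$ be a compact set and let $f:S\to\mathbb{R}$ be a $C^1$ function on $S$. Then for every $\varepsilon>0$ there exists a neural network $h:\mathbb{R}^d\to\mathbb{R}$ with a single hidden layer and ReLU activation which approximates $f$ on $S$ up to error $\varepsilon$ in the Sobolev space $\mathcal{S}_1$ of order 1. The same statement holds with the ReLU activation replaced by a leaky ReLU activation.
   Context: $f$ is $C^1$ on a compact set $S\subset\mathbb{R}^d$ if it is (the restriction to $S$ of) a function that is differentiable with continuous derivative on an open neighbourhood of $S$; its gradient on $S$ is the gradient of that function. ReLU is the function $t\mapsto \max(t,0)$. A leaky ReLU is a function $t\mapsto \max(t,at)$ for a fixed slope $a\in(0,1)$. A network with a single hidden layer and activation $\rho$ is a function of the form $h(x)=c_0+\sum_{i=1}^N c_i\,\rho(\langle w_i,x\rangle+b_i)$ with $N\in\mathbb{N}$, $w_i\in\mathbb{R}^d$, $b_i,c_i,c_0\in\mathbb{R}$. "$h$ approximates $f$ on $S$ up to error $\varepsilon$ in $\mathcal{S}_1$" means that both the values and the first derivatives are approximated: $|f(x)-h(x)|<\varepsilon$ for all $x\in S$, and $\|\nabla f(x)-\nabla h(x)\|<\varepsilon$ for all $x\in S$ outside the set of points at which $h$ is not differentiable (a set of Lebesgue measure zero). *)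

theory Defs
  imports "HOL-Analysis.Analysis"
begin

text \<open>
  For a general compact set \<open>S\<close> the gradient of a \<open>C\<^sup>1\<close> function on \<open>S\<close> is not determined by the
  values on \<open>S\<close>; it is the gradient of the chosen extension \<open>g\<close>. The predicate therefore carries
  the gradient \<open>Df\<close> as an argument. Only the values of \<open>f\<close> and \<open>Df\<close> on \<open>S\<close> matter.
\<close>

definition C1_on :: "(real ^ 'd) set \<Rightarrow> (real ^ 'd \<Rightarrow> real) \<Rightarrow> (real ^ 'd \<Rightarrow> real ^ 'd) \<Rightarrow> bool" where
  "C1_on S f Df \<longleftrightarrow>
     (\<exists>U g Dg. open U \<and> S \<subseteq> U \<and>
        (\<forall>x\<in>U. GDERIV g x :> Dg x) \<and> continuous_on U Dg \<and>
        (\<forall>x\<in>S. f x = g x \<and> Df x = Dg x))"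

definition relu :: "real \<Rightarrow> real" where
  "relu t = max t 0"

definition leaky_relu :: "real \<Rightarrow> real \<Rightarrow> real" where
  "leaky_relu a t = max t (a * t)"

definition single_layer_network :: "(real \<Rightarrow> real) \<Rightarrow> (real ^ 'd \<Rightarrow> real) \<Rightarrow> bool" where
  "single_layer_network \<rho> h \<longleftrightarrow>
     (\<exists>(N::nat) (w :: nat \<Rightarrow> real ^ 'd) (b :: nat \<Rightarrow> real) (c :: nat \<Rightarrow> real) (c0::real).
        h = (\<lambda>x. c0 + (\<Sum>i=1..N. c i * \<rho> (w i \<bullet> x + b i))))"

text \<open>
  A gradient \<open>D\<close> of \<open>h\<close> at \<open>x\<close> is unique, and it exists exactly where \<open>h\<close> is differentiable, so the
  last conjunct ranges over precisely the points of \<open>S\<close> at which \<open>h\<close> is differentiable.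
\<close>

definition approximates_S1 ::
  "(real ^ 'd) set \<Rightarrow> real \<Rightarrow> (real ^ 'd \<Rightarrow> real) \<Rightarrow> (real ^ 'd \<Rightarrow> real ^ 'd) \<Rightarrow> (real ^ 'd \<Rightarrow> real) \<Rightarrow> bool"
where
  "approximates_S1 S \<epsilon> f Df h \<longleftrightarrow>
     (\<forall>x\<in>S. \<bar>f x - h x\<bar> < \<epsilon>) \<and>
     {x. \<not> h differentiable (at x)} \<in> null_sets lebesgue \<and>
     (\<forall>x\<in>S. \<forall>D. GDERIV h x :> D \<longrightarrow> norm (Df x - D) < \<epsilon>)"

end

theory Submission imports Defs begin

text \<open>
  Closeness is measured by the supremum and the Lipschitz constant of the difference. If \<open>G - h\<close> is
  \<open>e\<close>-Lipschitz near \<open>x\<close> and both functions are differentiable at \<open>x\<close>, their gradients differ by at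
  most \<open>e\<close>; so no kink of a ReLU network needs separate treatment, even where kinks of several neurons
  cancel.

  Near \<open>S\<close>, a \<open>C\<^sup>1\<close> function is close to \<open>\<Sum>k. \<chi>\<^sub>k T\<^sub>k\<close>, where \<open>\<chi>\<^sub>k\<close> is a \<open>C\<^sup>1\<close> partition of
  unity on a grid of width \<open>h\<close> with tensor product bumps and \<open>T\<^sub>k\<close> is the first order Taylor polynomial
  at the grid point \<open>k\<close>: the gradient of \<open>\<chi>\<^sub>k\<close> is \<open>O(1/h)\<close>, but \<open>T\<^sub>k - f = o(h)\<close> on the support of
  \<open>\<chi>\<^sub>k\<close>. Each factor is a \<open>C\<^sup>1\<close> function of one linear form, hence a limit of sums of exponentials of
  linear forms. These sums form an algebra, so products remain limits of sums of ridge functions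
  \<open>exp (w \<bullet> x)\<close>, and the one-dimensional function \<open>exp\<close> is approximated by a piecewise linear
  function, i.e. a ReLU network, whose slope on each short interval is the derivative at the left end. Finally, ReLU is a combination
  of two leaky ReLUs.
\<close>

subsection \<open>Approximation in the Lipschitz sense\<close>

text \<open>A bound in the norm of bounded Lipschitz functions. It contains no derivative, so it
  applies to functions with kinks; on a nonempty \<open>B\<close> it forces \<open>C\<close> to be
  nonnegative.\<close>

definition lip_bounded :: "'a::real_normed_vector set \<Rightarrow> real \<Rightarrow> ('a \<Rightarrow> real) \<Rightarrow> bool" where
  "lip_bounded B C f \<longleftrightarrow>
     (\<forall>x\<in>B. \<bar>f x\<bar> \<le> C) \<and> (\<forall>x\<in>B. \<forall>y\<in>B. \<bar>f x - f y\<bar> \<le> C * norm (x - y))"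

lemma lip_boundedI:
  assumes "\<And>x. x \<in> B \<Longrightarrow> \<bar>f x\<bar> \<le> C"
    and "\<And>x y. x \<in> B \<Longrightarrow> y \<in> B \<Longrightarrow> \<bar>f x - f y\<bar> \<le> C * norm (x - y)"
  shows "lip_bounded B C f"
  using assms by (simp add: lip_bounded_def)

lemma lip_bounded_mono:
  assumes "lip_bounded B C f" "C \<le> D"
  shows "lip_bounded B D f"
  using assms unfolding lip_bounded_def
  by (meson mult_right_mono norm_ge_zero order_trans)

lemma lip_bounded_add:
  assumes "lip_bounded B C f" "lip_bounded B D g"
  shows "lip_bounded B (C + D) (\<lambda>x. f x + g x)"
proof (rule lip_boundedI)
  fix x assume "x \<in> B"
  then have "\<bar>f x\<bar> \<le> C" "\<bar>g x\<bar> \<le> D" using assms by (auto simp: lip_bounded_def)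
  then show "\<bar>f x + g x\<bar> \<le> C + D" by linarith
next
  fix x y assume "x \<in> B" "y \<in> B"
  then have "\<bar>f x - f y\<bar> \<le> C * norm (x - y)" "\<bar>g x - g y\<bar> \<le> D * norm (x - y)"
    using assms by (auto simp: lip_bounded_def)
  then show "\<bar>f x + g x - (f y + g y)\<bar> \<le> (C + D) * norm (x - y)"
    by (simp add: distrib_right)
qed

lemma lip_bounded_cmult:
  assumes "lip_bounded B C f"
  shows "lip_bounded B (\<bar>c\<bar> * C) (\<lambda>x. c * f x)"
proof (rule lip_boundedI)
  fix x assume "x \<in> B"
  then have "\<bar>f x\<bar> \<le> C" using assms by (auto simp: lip_bounded_def)
  then show "\<bar>c * f x\<bar> \<le> \<bar>c\<bar> * C" by (simp add: abs_mult mult_left_mono)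
next
  fix x y assume "x \<in> B" "y \<in> B"
  then have "\<bar>f x - f y\<bar> \<le> C * norm (x - y)" using assms by (auto simp: lip_bounded_def)
  then have "\<bar>c\<bar> * \<bar>f x - f y\<bar> \<le> \<bar>c\<bar> * (C * norm (x - y))" by (simp add: mult_left_mono)
  then show "\<bar>c * f x - c * f y\<bar> \<le> \<bar>c\<bar> * C * norm (x - y)"
    by (simp add: mult.assoc flip: abs_mult right_diff_distrib)
qed

text \<open>The increment of a product splits into two terms, as in the product rule, and each is at
  most \<open>C * D\<close> times the distance; hence the factor 2.\<close>

lemma lip_bounded_mult:
  assumes f: "lip_bounded B C f" and g: "lip_bounded B D g" and "0 \<le> C" "0 \<le> D"
  shows "lip_bounded B (2 * C * D) (\<lambda>x. f x * g x)"
proof (rule lip_boundedI)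
  fix x assume "x \<in> B"
  then have "\<bar>f x\<bar> \<le> C" "\<bar>g x\<bar> \<le> D" using f g by (auto simp: lip_bounded_def)
  then have "\<bar>f x * g x\<bar> \<le> C * D" by (simp add: abs_mult mult_mono' )
  moreover have "0 \<le> C * D" using assms by simp
  ultimately show "\<bar>f x * g x\<bar> \<le> 2 * C * D" by linarith
next
  fix x y assume xy: "x \<in> B" "y \<in> B"
  have "\<bar>f x\<bar> \<le> C" "\<bar>g y\<bar> \<le> D" "\<bar>f x - f y\<bar> \<le> C * norm (x - y)" "\<bar>g x - g y\<bar> \<le> D * norm (x - y)"
    using xy f g by (auto simp: lip_bounded_def)
  then have "\<bar>f x * (g x - g y)\<bar> \<le> C * (D * norm (x - y))"
    "\<bar>(f x - f y) * g y\<bar> \<le> C * norm (x - y) * D"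
    unfolding abs_mult using \<open>0 \<le> C\<close> \<open>0 \<le> D\<close> by (auto intro!: mult_mono)
  moreover have "f x * g x - f y * g y = f x * (g x - g y) + (f x - f y) * g y"
    by (simp add: algebra_simps)
  ultimately have "\<bar>f x * g x - f y * g y\<bar> \<le> C * (D * norm (x - y)) + C * norm (x - y) * D"
    by linarith
  then show "\<bar>f x * g x - f y * g y\<bar> \<le> 2 * C * D * norm (x - y)" by (simp add: algebra_simps)
qed

text \<open>Values keep the bound \<open>C\<close>, while Cauchy-Schwarz scales the Lipschitz
  constant by \<open>norm w\<close>. The factor \<open>1 + norm w\<close> dominates both and stays
  positive for \<open>w = 0\<close>.\<close>

lemma lip_bounded_ridge:
  assumes \<phi>: "lip_bounded T C \<phi>" and "0 \<le> C" and B: "\<And>x. x \<in> B \<Longrightarrow> w \<bullet> x \<in> T"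
  shows "lip_bounded B (C * (1 + norm w)) (\<lambda>x. \<phi> (w \<bullet> x))"
proof (rule lip_boundedI)
  fix x assume "x \<in> B"
  then have "\<bar>\<phi> (w \<bullet> x)\<bar> \<le> C" using \<phi> B by (auto simp: lip_bounded_def)
  moreover have "0 \<le> C * norm w" using \<open>0 \<le> C\<close> by simp
  ultimately show "\<bar>\<phi> (w \<bullet> x)\<bar> \<le> C * (1 + norm w)" unfolding distrib_left by linarith
next
  fix x y assume "x \<in> B" "y \<in> B"
  then have "\<bar>\<phi> (w \<bullet> x) - \<phi> (w \<bullet> y)\<bar> \<le> C * \<bar>w \<bullet> (x - y)\<bar>"
    using \<phi> B by (auto simp: lip_bounded_def inner_diff_right)
  also have "\<dots> \<le> C * (norm w * norm (x - y))"
    using \<open>0 \<le> C\<close> by (intro mult_left_mono Cauchy_Schwarz_ineq2)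
  also have "\<dots> \<le> C * ((1 + norm w) * norm (x - y))"
    using \<open>0 \<le> C\<close> by (intro mult_left_mono mult_right_mono) auto
  finally show "\<bar>\<phi> (w \<bullet> x) - \<phi> (w \<bullet> y)\<bar> \<le> C * (1 + norm w) * norm (x - y)" by simp
qed

text \<open>Along the line through \<open>x\<close> in direction \<open>D\<close> the difference
  quotients of \<open>u\<close> tend to \<open>D \<bullet> D\<close> and are at most
  \<open>C * norm D\<close>; cancel one \<open>norm D\<close>. This turns Lipschitz closeness into
  closeness of gradients.\<close>

lemma lip_bounded_gradient_le:
  fixes u :: "'a::real_inner \<Rightarrow> real"
  assumes "open B" "x \<in> B" and u: "lip_bounded B C u" and D: "GDERIV u x :> D"
  shows "norm D \<le> C"
proof (cases "D = 0")
  case True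
  then show ?thesis using assms by (auto simp: lip_bounded_def dest: bspec[of B _ x])
next
  case False
  have "((\<lambda>t. u (x + t *\<^sub>R D)) has_derivative (\<lambda>t. (t *\<^sub>R D) \<bullet> D)) (at 0)"
    using D unfolding gderiv_def
    by (intro has_derivative_compose[where f = "\<lambda>t. x + t *\<^sub>R D" and g = u and x = 0, simplified])
       (auto intro!: derivative_eq_intros)
  then have "((\<lambda>t. u (x + t *\<^sub>R D)) has_field_derivative (D \<bullet> D)) (at 0)"
    by (simp add: has_field_derivative_def mult.commute[of _ "D \<bullet> D"])
  then have lim: "((\<lambda>t. (u (x + t *\<^sub>R D) - u x) / t) \<longlongrightarrow> D \<bullet> D) (at 0)"
    by (simp add: DERIV_def)
  then have lim: "((\<lambda>t. \<bar>(u (x + t *\<^sub>R D) - u x) / t\<bar>) \<longlongrightarrow> \<bar>D \<bullet> D\<bar>) (at 0)"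
    by (rule tendsto_rabs)
  have "((\<lambda>t. x + t *\<^sub>R D) \<longlongrightarrow> x + 0 *\<^sub>R D) (at (0::real))"
    by (intro tendsto_intros)
  then have "\<forall>\<^sub>F t in at (0::real). x + t *\<^sub>R D \<in> B"
    using assms(1,2) by (auto simp: tendsto_def)
  then have "\<forall>\<^sub>F t in at (0::real). \<bar>(u (x + t *\<^sub>R D) - u x) / t\<bar> \<le> C * norm D"
    using eventually_neq_at_within[of "0::real"]
  proof eventually_elim
    case (elim t)
    then have "\<bar>u (x + t *\<^sub>R D) - u x\<bar> \<le> C * norm (x + t *\<^sub>R D - x)"
      using u \<open>x \<in> B\<close> unfolding lip_bounded_def by blast
    then show ?case using elim by (simp add: field_simps)
  qed
  then have "\<bar>D \<bullet> D\<bar> \<le> C * norm D"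
    using lim by (intro tendsto_upperbound[OF lim]) auto
  then have "norm D * norm D \<le> C * norm D"
    by (simp add: power2_norm_eq_inner flip: power2_eq_square)
  then show ?thesis using False by simp
qed

section \<open>Closure of a class of functions in the bounded Lipschitz norm\<close>

definition approximable :: "'a::real_normed_vector set \<Rightarrow> ('a \<Rightarrow> real) set \<Rightarrow> ('a \<Rightarrow> real) \<Rightarrow> bool" where
  "approximable B P f \<longleftrightarrow> (\<forall>e>0. \<exists>p\<in>P. lip_bounded B e (\<lambda>x. f x - p x))"

lemma approximable_self:
  assumes "p \<in> P"
  shows "approximable B P p"
  using assms by (auto simp: approximable_def lip_bounded_def intro!: bexI[of _ p])

lemma approximable_trans:
  assumes "approximable B P f" and PQ: "\<And>p. p \<in> P \<Longrightarrow> approximable B Q p"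
  shows "approximable B Q f"
  unfolding approximable_def
proof (intro allI impI)
  fix e :: real assume "e > 0"
  then obtain p where p: "p \<in> P" "lip_bounded B (e/2) (\<lambda>x. f x - p x)"
    using assms(1) half_gt_zero unfolding approximable_def by blast
  then obtain q where q: "q \<in> Q" "lip_bounded B (e/2) (\<lambda>x. p x - q x)"
    using PQ[OF p(1)] half_gt_zero[OF \<open>e > 0\<close>] unfolding approximable_def by blast
  have "lip_bounded B e (\<lambda>x. f x - q x)"
    using lip_bounded_add[OF p(2) q(2)] by simp
  then show "\<exists>q\<in>Q. lip_bounded B e (\<lambda>x. f x - q x)" using q by blast
qed

lemma approximable_add:
  assumes "approximable B P f" "approximable B P g"
    and add: "\<And>p q. p \<in> P \<Longrightarrow> q \<in> P \<Longrightarrow> (\<lambda>x. p x + q x) \<in> P"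
  shows "approximable B P (\<lambda>x. f x + g x)"
  unfolding approximable_def
proof (intro allI impI)
  fix e :: real assume "e > 0"
  then obtain p q where p: "p \<in> P" "lip_bounded B (e/2) (\<lambda>x. f x - p x)"
    and q: "q \<in> P" "lip_bounded B (e/2) (\<lambda>x. g x - q x)"
    using assms(1,2) half_gt_zero unfolding approximable_def by meson
  have "lip_bounded B e (\<lambda>x. f x + g x - (p x + q x))"
    using lip_bounded_add[OF p(2) q(2)] by (simp add: algebra_simps)
  then show "\<exists>r\<in>P. lip_bounded B e (\<lambda>x. f x + g x - r x)" by (rule bexI[OF _ add[OF p(1) q(1)]])
qed

lemma approximable_cmult:
  assumes "approximable B P f"
    and cmult: "\<And>c p. p \<in> P \<Longrightarrow> (\<lambda>x. c * p x) \<in> P"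
  shows "approximable B P (\<lambda>x. c * f x)"
  unfolding approximable_def
proof (intro allI impI)
  fix e :: real assume "e > 0"
  \<comment> \<open>The summand 1 covers \<open>c = 0\<close>.\<close>
  then have "e / (\<bar>c\<bar> + 1) > 0" by (intro divide_pos_pos) auto
  then obtain p where p: "p \<in> P" "lip_bounded B (e / (\<bar>c\<bar> + 1)) (\<lambda>x. f x - p x)"
    using assms(1) unfolding approximable_def by meson
  have "\<bar>c\<bar> * (e / (\<bar>c\<bar> + 1)) \<le> e" using \<open>e > 0\<close> by (simp add: field_simps)
  then have "lip_bounded B e (\<lambda>x. c * f x - c * p x)"
    using lip_bounded_mono[OF lip_bounded_cmult[OF p(2), of c]] by (simp add: algebra_simps)
  then show "\<exists>r\<in>P. lip_bounded B e (\<lambda>x. c * f x - r x)" by (rule bexI[OF _ cmult[OF p(1)]])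
qed

lemma approximable_lip_bounded:
  assumes "approximable B P f" and P: "\<And>p. p \<in> P \<Longrightarrow> \<exists>C. lip_bounded B C p"
  obtains C where "C > 0" "lip_bounded B C f"
proof -
  obtain p where p: "p \<in> P" "lip_bounded B 1 (\<lambda>x. f x - p x)"
    using assms(1) zero_less_one unfolding approximable_def by meson
  obtain C where C: "lip_bounded B C p" using P[OF p(1)] by blast
  have "lip_bounded B (1 + C) f" using lip_bounded_add[OF p(2) C] by simp
  then have "lip_bounded B (1 + \<bar>C\<bar>) f" by (rule lip_bounded_mono) simp
  then show thesis by (intro that) auto
qed

text \<open>Write \<open>f * g - p * q\<close> as \<open>(f - p) * g + p * (g - q)\<close>. The
  tolerance for \<open>q\<close> depends on the bound of \<open>p\<close>, so \<open>p\<close> is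
  chosen first. The factor 4 in the tolerances absorbs the 2 of \<open>lip_bounded_mult\<close> and
  leaves \<open>e / 2\<close> for each term.\<close>

lemma approximable_mult:
  assumes f: "approximable B P f" and g: "approximable B P g"
    and P: "\<And>p. p \<in> P \<Longrightarrow> \<exists>C. lip_bounded B C p"
    and mult: "\<And>p q. p \<in> P \<Longrightarrow> q \<in> P \<Longrightarrow> (\<lambda>x. p x * q x) \<in> P"
  shows "approximable B P (\<lambda>x. f x * g x)"
  unfolding approximable_def
proof (intro allI impI)
  fix e :: real assume "e > 0"
  obtain C where C: "C > 0" "lip_bounded B C g"
    using approximable_lip_bounded[OF g P] by blast
  have "e / (4 * C) > 0" using C \<open>e > 0\<close> by simp
  then obtain p where p: "p \<in> P" "lip_bounded B (e / (4 * C)) (\<lambda>x. f x - p x)"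
    using f unfolding approximable_def by meson
  obtain D where D: "D > 0" "lip_bounded B D p"
    using approximable_lip_bounded[OF approximable_self[OF p(1)] P] by blast
  have "e / (4 * D) > 0" using D \<open>e > 0\<close> by simp
  then obtain q where q: "q \<in> P" "lip_bounded B (e / (4 * D)) (\<lambda>x. g x - q x)"
    using g unfolding approximable_def by meson
  have "lip_bounded B (2 * (e / (4 * C)) * C) (\<lambda>x. (f x - p x) * g x)"
    using p C \<open>e > 0\<close> by (intro lip_bounded_mult) auto
  moreover have "lip_bounded B (2 * D * (e / (4 * D))) (\<lambda>x. p x * (g x - q x))"
    using q D \<open>e > 0\<close> by (intro lip_bounded_mult) auto
  ultimately have "lip_bounded B e (\<lambda>x. (f x - p x) * g x + p x * (g x - q x))"
    using C(1) D(1) by (auto dest: lip_bounded_add simp: field_simps)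
  then have "lip_bounded B e (\<lambda>x. f x * g x - p x * q x)" by (simp add: algebra_simps)
  then show "\<exists>r\<in>P. lip_bounded B e (\<lambda>x. f x * g x - r x)" by (rule bexI[OF _ mult[OF p(1) q(1)]])
qed

subsection \<open>Single-layer networks\<close>

lemma single_layer_networkE:
  assumes "single_layer_network \<rho> h"
  obtains N :: nat and w b c c0 where "h = (\<lambda>x. c0 + (\<Sum>i=1..N. c i * \<rho> (w i \<bullet> x + b i)))"
  using assms unfolding single_layer_network_def by (elim exE) (rule that)

lemma single_layer_networkI:
  assumes "\<And>x. h x = c0 + (\<Sum>i=1..(N::nat). c i * \<rho> (w i \<bullet> x + b i))"
  shows "single_layer_network \<rho> h"
  unfolding single_layer_network_def using assms by (intro exI ext)

lemma single_layer_network_const: "single_layer_network \<rho> (\<lambda>x. c)"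
  unfolding single_layer_network_def by (rule exI[of _ 0]) auto

lemma single_layer_network_neuron: "single_layer_network \<rho> (\<lambda>x. c * \<rho> (w \<bullet> x + b))"
  unfolding single_layer_network_def
  by (rule exI[of _ 1], rule exI[of _ "\<lambda>_. w"], rule exI[of _ "\<lambda>_. b"], rule exI[of _ "\<lambda>_. c"],
      rule exI[of _ 0]) auto

text \<open>The two hidden layers are concatenated: neuron \<open>i\<close> of the second network
  becomes neuron \<open>N + i\<close>.\<close>

lemma single_layer_network_add:
  assumes "single_layer_network \<rho> g" "single_layer_network \<rho> h"
  shows "single_layer_network \<rho> (\<lambda>x. g x + h x)"
proof -
  obtain N :: nat and w b c c0 where g: "g = (\<lambda>x. c0 + (\<Sum>i=1..N. c i * \<rho> (w i \<bullet> x + b i)))"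
    using assms(1) by (rule single_layer_networkE)
  obtain N' :: nat and w' b' c' c0' where h: "h = (\<lambda>x. c0' + (\<Sum>i=1..N'. c' i * \<rho> (w' i \<bullet> x + b' i)))"
    using assms(2) by (rule single_layer_networkE)
  define w'' where "w'' i = (if i \<le> N then w i else w' (i - N))" for i
  define b'' where "b'' i = (if i \<le> N then b i else b' (i - N))" for i
  define c'' where "c'' i = (if i \<le> N then c i else c' (i - N))" for i
  have "g x + h x = (c0 + c0') + (\<Sum>i=1..N+N'. c'' i * \<rho> (w'' i \<bullet> x + b'' i))" for x
  proof -
    have "(\<Sum>i=1..N+N'. c'' i * \<rho> (w'' i \<bullet> x + b'' i)) =
      (\<Sum>i=1..N. c'' i * \<rho> (w'' i \<bullet> x + b'' i)) + (\<Sum>i=N+1..N+N'. c'' i * \<rho> (w'' i \<bullet> x + b'' i))"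
      by (rule sum.ub_add_nat) simp
    also have "(\<Sum>i=N+1..N+N'. c'' i * \<rho> (w'' i \<bullet> x + b'' i)) =
        (\<Sum>i=1..N'. c'' (i+N) * \<rho> (w'' (i+N) \<bullet> x + b'' (i+N)))"
      using sum.shift_bounds_cl_nat_ivl[of "\<lambda>i. c'' i * \<rho> (w'' i \<bullet> x + b'' i)" 1 N N']
      by (simp add: add.commute)
    also have "\<dots> = (\<Sum>i=1..N'. c' i * \<rho> (w' i \<bullet> x + b' i))"
      by (intro sum.cong) (auto simp: w''_def b''_def c''_def)
    also have "(\<Sum>i=1..N. c'' i * \<rho> (w'' i \<bullet> x + b'' i)) = (\<Sum>i=1..N. c i * \<rho> (w i \<bullet> x + b i))"
      by (intro sum.cong) (auto simp: w''_def b''_def c''_def)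
    finally show ?thesis by (simp add: g h)
  qed
  then show ?thesis by (rule single_layer_networkI)
qed

lemma single_layer_network_cmult:
  assumes "single_layer_network \<rho> g"
  shows "single_layer_network \<rho> (\<lambda>x. k * g x)"
proof -
  obtain N :: nat and w b c c0 where g: "g = (\<lambda>x. c0 + (\<Sum>i=1..N. c i * \<rho> (w i \<bullet> x + b i)))"
    using assms by (rule single_layer_networkE)
  have "k * g x = k * c0 + (\<Sum>i=1..N. (k * c i) * \<rho> (w i \<bullet> x + b i))" for x
    by (simp add: g distrib_left sum_distrib_left mult.assoc)
  then show ?thesis by (rule single_layer_networkI)
qed

lemma single_layer_network_sum:
  assumes "finite I" "\<And>i. i \<in> I \<Longrightarrow> single_layer_network \<rho> (h i)"
  shows "single_layer_network \<rho> (\<lambda>x. \<Sum>i\<in>I. h i x)"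
  using assms
  by (induction I rule: finite_induct) (auto intro: single_layer_network_const single_layer_network_add)

text \<open>For \<open>t \<ge> 0\<close> the two terms of the numerator are \<open>t\<close> and
  \<open>- a\<^sup>2 * t\<close>; for \<open>t \<le> 0\<close> they are \<open>a * t\<close> and
  \<open>- a * t\<close>, which cancel.\<close>

lemma relu_eq_leaky_relu:
  assumes "0 < a" "a < 1"
  shows "relu t = (leaky_relu a t + a * leaky_relu a (- t)) / (1 - a\<^sup>2)"
proof -
  have "a\<^sup>2 < 1" using assms by (simp add: abs_square_less_1)
  then show ?thesis
    using assms unfolding relu_def leaky_relu_def max_def
    by (auto simp: divide_simps power2_eq_square algebra_simps mult_le_0_iff)
qed

lemma single_layer_network_leaky_relu:
  assumes "0 < a" "a < 1" "single_layer_network relu h"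
  shows "single_layer_network (leaky_relu a) h"
proof -
  obtain N :: nat and w b c c0 where h: "h = (\<lambda>x. c0 + (\<Sum>i=1..N. c i * relu (w i \<bullet> x + b i)))"
    using assms(3) by (rule single_layer_networkE)
  have "single_layer_network (leaky_relu a) (\<lambda>x. c i * relu (w i \<bullet> x + b i))" for i
  proof -
    have "single_layer_network (leaky_relu a) (\<lambda>x.
        c i / (1 - a\<^sup>2) * leaky_relu a (w i \<bullet> x + b i) +
        c i * a / (1 - a\<^sup>2) * leaky_relu a ((- w i) \<bullet> x + (- b i)))"
      by (intro single_layer_network_add single_layer_network_neuron)
    also have "(\<lambda>x. c i / (1 - a\<^sup>2) * leaky_relu a (w i \<bullet> x + b i) +
        c i * a / (1 - a\<^sup>2) * leaky_relu a ((- w i) \<bullet> x + (- b i))) =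
        (\<lambda>x. c i * relu (w i \<bullet> x + b i))"
      by (simp add: relu_eq_leaky_relu[OF assms(1,2)] add_divide_distrib distrib_left fun_eq_iff)
    finally show ?thesis .
  qed
  then show ?thesis
    unfolding h
    by (intro single_layer_network_add single_layer_network_const single_layer_network_sum
        finite_atLeastAtMost)
qed

text \<open>Off the finitely many hyperplanes where the argument of a nonconstant neuron vanishes,
  every neuron is differentiable. Only an inclusion is needed, so kinks that cancel do no
  harm.\<close>

lemma null_set_not_differentiable_relu_network:
  assumes "single_layer_network relu h"
  shows "{x. \<not> h differentiable (at x)} \<in> null_sets lebesgue"
proof -
  obtain N :: nat and w b c c0 where h: "h = (\<lambda>x. c0 + (\<Sum>i=1..N. c i * relu (w i \<bullet> x + b i)))"
    using assms by (rule single_layer_networkE)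
  \<comment> \<open>With \<open>w i = 0\<close> and \<open>b i = 0\<close> the equation would hold
    everywhere, although that neuron is constant; the guard makes the set empty.\<close>
  define H where "H i = {x. w i \<noteq> 0 \<and> w i \<bullet> x = - b i}" for i
  have negl: "negligible (H i)" for i
    by (cases "w i = 0") (auto simp: H_def intro: negligible_hyperplane)
  have relu: "relu differentiable (at t)" if "t \<noteq> 0" for t
  proof (cases "t > 0")
    case True
    have "(relu has_real_derivative 1) (at t)"
      by (rule has_field_derivative_transform_within_open[of "\<lambda>t. t" _ _ "{0<..}"])
         (use True in \<open>auto simp: relu_def\<close>)
    then show ?thesis by (rule differentiableI[OF has_field_derivative_imp_has_derivative])
  next
    case False
    have "(relu has_real_derivative 0) (at t)"
      by (rule has_field_derivative_transform_within_open[of "\<lambda>t. 0" _ _ "{..<0}"])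
         (use False that in \<open>auto simp: relu_def\<close>)
    then show ?thesis by (rule differentiableI[OF has_field_derivative_imp_has_derivative])
  qed
  have "(\<lambda>x. relu (w i \<bullet> x + b i)) differentiable (at x)" if "x \<notin> H i" for x i
  proof (cases "w i = 0")
    case False
    then have "w i \<bullet> x + b i \<noteq> 0" using that by (auto simp: H_def)
    moreover have "(\<lambda>x. w i \<bullet> x + b i) differentiable (at x)"
      by (intro differentiable_add differentiable_const bounded_linear_imp_differentiable
          bounded_linear_inner_right)
    ultimately show ?thesis
      using differentiable_chain_at[of "\<lambda>x. w i \<bullet> x + b i" x relu] relu by (simp add: o_def)
  qed simp
  then have "h differentiable (at x)" if "x \<notin> (\<Union>i\<in>{1..N}. H i)" for x
    unfolding h using that
    by (intro differentiable_add differentiable_const differentiable_sum differentiable_mult ballI) auto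
  then have "{x. \<not> h differentiable (at x)} \<subseteq> (\<Union>i\<in>{1..N}. H i)" by blast
  moreover have "negligible (\<Union>i\<in>{1..N}. H i)" using negl by (intro negligible_Union) auto
  ultimately show ?thesis using negligible_subset negligible_iff_null_sets by blast
qed

section \<open>Piecewise linear approximation in one variable\<close>

lemma relu_network_approx_1d:
  fixes \<phi> \<phi>' :: "real \<Rightarrow> real"
  assumes "a \<le> b" "0 < e"
    and deriv: "\<And>t. t \<in> {a..b} \<Longrightarrow> (\<phi> has_real_derivative \<phi>' t) (at t)"
    and cont: "continuous_on {a..b} \<phi>'"
  obtains r where "\<And>w :: real ^ 'd. single_layer_network relu (\<lambda>x. r (w \<bullet> x))"
    and "lip_bounded {a..b} e (\<lambda>t. \<phi> t - r t)"
proof -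
  \<comment> \<open>The difference will vanish at \<open>a\<close>, so a Lipschitz constant
    \<open>e'\<close> bounds its values by \<open>e' * (b - a)\<close>. The denominator makes this
    and \<open>e'\<close> itself at most \<open>e\<close>.\<close>
  define e' where "e' = e / (1 + (b - a))"
  have "e' > 0" using assms by (simp add: e'_def)
  obtain d where d: "d > 0"
    and unif: "\<And>x y. x \<in> {a..b} \<Longrightarrow> y \<in> {a..b} \<Longrightarrow> \<bar>x - y\<bar> < d \<Longrightarrow> \<bar>\<phi>' x - \<phi>' y\<bar> < e'"
    using compact_uniformly_continuous[OF cont compact_Icc] \<open>e' > 0\<close>
    unfolding uniformly_continuous_on_def dist_real_def by metis
  obtain n :: nat where n: "(b - a) / d < real n" using reals_Archimedean2 by blast
  have "n > 0" using n d \<open>a \<le> b\<close>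
    by (metis diff_ge_0_iff_ge divide_nonneg_pos gr0I not_le of_nat_0)
  define \<delta> where "\<delta> = (b - a) / real n"
  have \<delta>: "0 \<le> \<delta>" "\<delta> < d" "a + real n * \<delta> = b"
    using n d \<open>a \<le> b\<close> \<open>n > 0\<close> by (auto simp: \<delta>_def field_simps)
  let ?lip = "\<lambda>r q. \<forall>x\<in>{a..q}. \<forall>y\<in>{a..q}. \<bar>(\<phi> x - r x) - (\<phi> y - r y)\<bar> \<le> e' * \<bar>x - y\<bar>"
  \<comment> \<open>The knots \<open>a + m * \<delta>\<close> are treated from left to right. The
    last clause records that \<open>r\<close> is affine beyond the current knot, with a slope
    \<open>s\<close> that the next neuron must correct. Networks live on \<open>real ^ 'd\<close>,
    so the one-variable \<open>r\<close> enters through its ridge functions.\<close>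
  have "\<exists>r s. (\<forall>w :: real ^ 'd. single_layer_network relu (\<lambda>x. r (w \<bullet> x))) \<and> r a = \<phi> a \<and>
      ?lip r (a + real m * \<delta>) \<and>
      (\<forall>t \<ge> a + real m * \<delta>. r t = r (a + real m * \<delta>) + s * (t - (a + real m * \<delta>)))"
    if "m \<le> n" for m
    using that
  proof (induction m)
    case 0
    show ?case
      by (rule exI[of _ "\<lambda>_. \<phi> a"], rule exI[of _ 0]) (auto intro: single_layer_network_const)
  next
    case (Suc m)
    define p where "p = a + real m * \<delta>"
    define q where "q = p + \<delta>"
    have q: "a + real (Suc m) * \<delta> = q" by (simp add: q_def p_def algebra_simps)
    have "real (Suc m) * \<delta> \<le> real n * \<delta>"
      using Suc.prems \<delta>(1) by (intro mult_right_mono) auto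
    then have pq: "a \<le> p" "p \<le> q" "q \<le> b" "q - p < d"
      using \<delta> q by (auto simp: q_def p_def)
    obtain r s where r: "\<And>w :: real ^ 'd. single_layer_network relu (\<lambda>x. r (w \<bullet> x))" "r a = \<phi> a"
      and lip: "?lip r p" and s: "\<And>t. t \<ge> p \<Longrightarrow> r t = r p + s * (t - p)"
      using Suc unfolding p_def by auto
    \<comment> \<open>The new neuron is zero up to \<open>p\<close> and changes the slope after
      \<open>p\<close> from \<open>s\<close> to \<open>\<phi>' p\<close>.\<close>
    define r' where "r' t = r t + (\<phi>' p - s) * relu (t + (- p))" for t
    have r'_left: "r' t = r t" if "t \<le> p" for t
      using that by (simp add: r'_def relu_def)
    have r'_right: "r' t = r p + \<phi>' p * (t - p)" if "t \<ge> p" for t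
      using that s[OF that] by (simp add: r'_def relu_def algebra_simps)
    have net: "single_layer_network relu (\<lambda>x. r' (w \<bullet> x))" for w :: "real ^ 'd"
      unfolding r'_def by (intro single_layer_network_add r single_layer_network_neuron)
    have left: "\<bar>(\<phi> x - r' x) - (\<phi> y - r' y)\<bar> \<le> e' * \<bar>x - y\<bar>" if "x \<in> {a..p}" "y \<in> {a..p}" for x y
      using lip that by (simp add: r'_left)
    \<comment> \<open>Mean value inequality: on this interval, shorter than \<open>d\<close>, the
      difference has derivative \<open>\<phi>' z - \<phi>' p\<close>, which uniform continuity
      bounds by \<open>e'\<close>.\<close>
    have right: "\<bar>(\<phi> x - r' x) - (\<phi> y - r' y)\<bar> \<le> e' * \<bar>x - y\<bar>" if "x \<in> {p..q}" "y \<in> {p..q}" for x y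
    proof -
      have "norm ((\<phi> x - \<phi>' p * (x - p)) - (\<phi> y - \<phi>' p * (y - p))) \<le> e' * norm (x - y)"
      proof (rule field_differentiable_bound[OF convex_closed_interval[of p q]])
        fix z assume z: "z \<in> {p..q}"
        have "(\<phi> has_real_derivative \<phi>' z) (at z within {p..q})"
          using z pq by (intro has_field_derivative_at_within[OF deriv]) auto
        then show "((\<lambda>z. \<phi> z - \<phi>' p * (z - p)) has_real_derivative (\<phi>' z - \<phi>' p)) (at z within {p..q})"
          by (auto intro!: derivative_eq_intros)
        show "norm (\<phi>' z - \<phi>' p) \<le> e'"
          using unif[of z p] z pq by auto
      qed (use that in auto)
      then show ?thesis using that by (simp add: r'_right)
    qed
    \<comment> \<open>For points on opposite sides of \<open>p\<close>, pass through
      \<open>p\<close>: distances on a line add up, so the constant does not grow with the number of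
      knots.\<close>
    have ordered: "\<bar>(\<phi> x - r' x) - (\<phi> y - r' y)\<bar> \<le> e' * \<bar>x - y\<bar>"
      if xy: "a \<le> x" "x \<le> y" "y \<le> q" for x y
    proof (cases "p \<le> x \<or> y \<le> p")
      case True
      then show ?thesis using left[of x y] right[of x y] xy by auto
    next
      case False
      then have "\<bar>(\<phi> x - r' x) - (\<phi> p - r' p)\<bar> \<le> e' * \<bar>x - p\<bar>"
        "\<bar>(\<phi> p - r' p) - (\<phi> y - r' y)\<bar> \<le> e' * \<bar>p - y\<bar>"
        using left[of x p] right[of p y] xy by auto
      moreover have "e' * \<bar>x - p\<bar> + e' * \<bar>p - y\<bar> = e' * \<bar>x - y\<bar>"
        using False by (simp add: algebra_simps)
      ultimately show ?thesis by linarith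
    qed
    have "?lip r' q"
    proof (intro ballI)
      fix x y assume "x \<in> {a..q}" "y \<in> {a..q}"
      then show "\<bar>(\<phi> x - r' x) - (\<phi> y - r' y)\<bar> \<le> e' * \<bar>x - y\<bar>"
        using ordered[of x y] ordered[of y x] by (cases "x \<le> y") (auto simp: abs_minus_commute)
    qed
    moreover have "r' a = \<phi> a" using r'_left[of a] pq r by simp
    moreover have "\<forall>t\<ge>q. r' t = r' q + \<phi>' p * (t - q)"
      using pq by (auto simp: r'_right algebra_simps)
    ultimately show ?case unfolding q using net by blast
  qed
  from this[OF order_refl] obtain r where r: "\<And>w :: real ^ 'd. single_layer_network relu (\<lambda>x. r (w \<bullet> x))"
    "r a = \<phi> a" and lip: "?lip r b"
    unfolding \<delta>(3) by blast
  have "lip_bounded {a..b} e (\<lambda>t. \<phi> t - r t)"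
  proof (rule lip_boundedI)
    fix x assume x: "x \<in> {a..b}"
    then have "\<bar>\<phi> x - r x\<bar> \<le> e' * (x - a)"
      using lip[rule_format, of x a] r(2) by simp
    also have "\<dots> \<le> e' * (1 + (b - a))" using x \<open>e' > 0\<close> by (intro mult_left_mono) auto
    also have "\<dots> = e" using \<open>a \<le> b\<close> by (simp add: e'_def)
    finally show "\<bar>\<phi> x - r x\<bar> \<le> e" .
  next
    fix x y assume "x \<in> {a..b}" "y \<in> {a..b}"
    then have "\<bar>(\<phi> x - r x) - (\<phi> y - r y)\<bar> \<le> e' * \<bar>x - y\<bar>" using lip by blast
    also have "\<dots> \<le> e * \<bar>x - y\<bar>"
      using \<open>a \<le> b\<close> \<open>0 < e\<close> by (intro mult_right_mono) (auto simp: e'_def field_simps)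
    finally show "\<bar>(\<phi> x - r x) - (\<phi> y - r y)\<bar> \<le> e * norm (x - y)" by simp
  qed
  with r(1) show thesis by (rule that)
qed

text \<open>The one-variable tolerance is \<open>e / (1 + norm w)\<close>, which offsets the loss in
  \<open>lip_bounded_ridge\<close>.\<close>

lemma approximable_ridge:
  assumes "\<And>e. e > 0 \<Longrightarrow> \<exists>r. (\<lambda>x. r (w \<bullet> x)) \<in> P \<and> lip_bounded T e (\<lambda>t. \<phi> t - r t)"
    and "\<And>x. x \<in> B \<Longrightarrow> w \<bullet> x \<in> T"
  shows "approximable B P (\<lambda>x. \<phi> (w \<bullet> x))"
  unfolding approximable_def
proof (intro allI impI)
  fix e :: real assume "e > 0"
  have n: "1 + norm w > 0" by (simp add: add_pos_nonneg)
  then have "e / (1 + norm w) > 0" using \<open>e > 0\<close> by simp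
  then obtain r where r: "(\<lambda>x. r (w \<bullet> x)) \<in> P" "lip_bounded T (e / (1 + norm w)) (\<lambda>t. \<phi> t - r t)"
    using assms(1) by blast
  have "lip_bounded B (e / (1 + norm w) * (1 + norm w)) (\<lambda>x. \<phi> (w \<bullet> x) - r (w \<bullet> x))"
    using r(2) assms(2) \<open>e > 0\<close> by (intro lip_bounded_ridge) auto
  then have "lip_bounded B e (\<lambda>x. \<phi> (w \<bullet> x) - r (w \<bullet> x))" using n by simp
  then show "\<exists>p\<in>P. lip_bounded B e (\<lambda>x. \<phi> (w \<bullet> x) - p x)" by (rule bexI[OF _ r(1)])
qed

lemma inner_mem_Icc_if_mem_ball:
  assumes "x \<in> ball 0 R"
  shows "w \<bullet> x \<in> {- (norm w * R)..norm w * R}"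
proof -
  have "\<bar>w \<bullet> x\<bar> \<le> norm w * norm x" by (rule Cauchy_Schwarz_ineq2)
  also have "\<dots> \<le> norm w * R" using assms by (intro mult_left_mono) auto
  finally show ?thesis by auto
qed

subsection \<open>The algebra of exponential sums\<close>

inductive_set exp_sums :: "('a::real_inner \<Rightarrow> real) set" where
  exp_sums_exp: "(\<lambda>x. exp (w \<bullet> x)) \<in> exp_sums"
| exp_sums_add: "f \<in> exp_sums \<Longrightarrow> g \<in> exp_sums \<Longrightarrow> (\<lambda>x. f x + g x) \<in> exp_sums"
| exp_sums_cmult: "f \<in> exp_sums \<Longrightarrow> (\<lambda>x. c * f x) \<in> exp_sums"

lemma exp_sums_const: "(\<lambda>x. c) \<in> exp_sums"
  using exp_sums_cmult[OF exp_sums_exp[of 0], of c] by simp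

text \<open>By bilinearity, a nested induction reduces the claim to two generators, whose exponents
  add. This is where a product of ridge functions becomes a sum of ridge functions.\<close>

lemma exp_sums_mult:
  assumes "f \<in> exp_sums" "g \<in> exp_sums"
  shows "(\<lambda>x. f x * g x) \<in> exp_sums"
  using assms(1)
proof induction
  case (exp_sums_exp w)
  show ?case using assms(2)
  proof induction
    case (exp_sums_exp v)
    show ?case using exp_sums.exp_sums_exp[of "w + v"] by (simp add: inner_add_left exp_add)
  next
    case (exp_sums_add f g)
    then show ?case using exp_sums.exp_sums_add by (fastforce simp: distrib_left)
  next
    case (exp_sums_cmult f c)
    then show ?case using exp_sums.exp_sums_cmult[of _ c] by (fastforce simp: mult.left_commute)
  qed
next
  case (exp_sums_add f h)
  then show ?case using exp_sums.exp_sums_add by (fastforce simp: distrib_right)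
next
  case (exp_sums_cmult f c)
  then show ?case using exp_sums.exp_sums_cmult[of _ c] by (fastforce simp: mult.assoc)
qed

lemma exp_sums_sum:
  assumes "finite I" "\<And>i. i \<in> I \<Longrightarrow> f i \<in> exp_sums"
  shows "(\<lambda>x. \<Sum>i\<in>I. f i x) \<in> exp_sums"
  using assms by (induction I rule: finite_induct) (auto intro: exp_sums_const exp_sums_add)

lemma exp_sums_power:
  assumes "f \<in> exp_sums"
  shows "(\<lambda>x. f x ^ n) \<in> exp_sums"
  using assms by (induction n) (auto intro: exp_sums_const exp_sums_mult)

lemma exp_sums_lip_bounded:
  assumes "f \<in> exp_sums"
  shows "\<exists>C. lip_bounded (ball 0 R) C f"
  using assms
proof induction
  case (exp_sums_exp w)
  define T where "T = norm w * R"
  \<comment> \<open>On this interval \<open>exp T\<close> bounds \<open>exp\<close> and also its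
    derivative.\<close>
  have "lip_bounded {-T..T} (exp T) exp"
  proof (rule lip_boundedI)
    fix x y assume xy: "x \<in> {-T..T}" "y \<in> {-T..T}"
    show "\<bar>exp x - exp y\<bar> \<le> exp T * norm (x - y)"
      using field_differentiable_bound[of "{-T..T}" exp exp "exp T" x y] xy
      by (auto intro: DERIV_exp has_field_derivative_at_within)
  qed auto
  then show ?case
    using lip_bounded_ridge[of "{-T..T}" "exp T" exp "ball 0 R" w] inner_mem_Icc_if_mem_ball[of _ R w]
    unfolding T_def by fastforce
qed (blast intro: lip_bounded_add lip_bounded_cmult)+

lemma exp_sums_approximable_by_networks:
  fixes p :: "real ^ 'd \<Rightarrow> real"
  assumes "p \<in> exp_sums" "0 \<le> R"
  shows "approximable (ball 0 R) {h. single_layer_network relu h} p"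
  using assms(1)
proof induction
  case (exp_sums_exp w)
  show ?case
  proof (rule approximable_ridge[OF _ inner_mem_Icc_if_mem_ball])
    fix e :: real assume "e > 0"
    have T: "- (norm w * R) \<le> norm w * R" using \<open>0 \<le> R\<close> by simp
    obtain r where "\<And>w :: real ^ 'd. single_layer_network relu (\<lambda>x. r (w \<bullet> x))"
      "lip_bounded {- (norm w * R)..norm w * R} e (\<lambda>t. exp t - r t)"
      by (rule relu_network_approx_1d[OF T \<open>e > 0\<close> DERIV_exp continuous_on_exp[OF continuous_on_id]]) blast
    then show "\<exists>r. (\<lambda>x. r (w \<bullet> x)) \<in> {h. single_layer_network relu h} \<and>
        lip_bounded {- (norm w * R)..norm w * R} e (\<lambda>t. exp t - r t)" by blast
  qed
next
  case (exp_sums_add f g)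
  then show ?case by (auto intro: approximable_add single_layer_network_add)
next
  case (exp_sums_cmult f c)
  then show ?case by (auto intro: approximable_cmult single_layer_network_cmult)
qed

text \<open>In the variable \<open>s = exp t\<close>, exponential sums are polynomials; the Weierstrass theorem is applied
  to the derivative of \<open>\<phi>\<close> in this variable and the result is integrated.\<close>

lemma approximable_C1_ridge:
  fixes \<phi> \<phi>' :: "real \<Rightarrow> real" and w :: "'a::real_inner"
  assumes deriv: "\<And>t. (\<phi> has_real_derivative \<phi>' t) (at t)"
    and cont: "continuous_on UNIV \<phi>'" and "0 \<le> R"
  shows "approximable (ball 0 R) exp_sums (\<lambda>x. \<phi> (w \<bullet> x))"
proof (rule approximable_ridge[OF _ inner_mem_Icc_if_mem_ball])
  fix e :: real assume "e > 0"
  define T where "T = norm w * R"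
  have "T \<ge> 0" using \<open>0 \<le> R\<close> by (simp add: T_def)
  define K where "K = e / (1 + T)"
  have K: "K > 0" "K * T \<le> e" "K \<le> e"
    using \<open>e > 0\<close> \<open>T \<ge> 0\<close> by (auto simp: K_def field_simps)
  have pos: "s \<noteq> 0" if "s \<in> {exp (- T)..exp T}" for s
    using that less_le_trans[OF exp_gt_zero, of "- T" s] by auto
  have ln: "continuous_on {exp (- T)..exp T} ln"
    by (intro continuous_on_ln continuous_on_id ballI pos)
  \<comment> \<open>This is the derivative of \<open>\<phi> (ln s)\<close> with respect to
    \<open>s\<close>.\<close>
  have \<psi>: "continuous_on {exp (- T)..exp T} (\<lambda>s. \<phi>' (ln s) / s)"
    by (intro continuous_on_divide continuous_on_id continuous_on_compose2[OF cont ln] subset_UNIV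
        ballI pos)
  \<comment> \<open>Returning from \<open>s\<close> to \<open>t\<close> multiplies derivatives by
    \<open>exp t\<close>, which is at most \<open>exp T\<close>.\<close>
  have "K / exp T > 0" using K by simp
  from Stone_Weierstrass_real_polynomial_function[OF compact_Icc \<psi> this]
  obtain P where P: "real_polynomial_function P"
    "\<And>s. s \<in> {exp (- T)..exp T} \<Longrightarrow> \<bar>\<phi>' (ln s) / s - P s\<bar> < K / exp T"
    by blast
  obtain c n where c: "P = (\<lambda>s. \<Sum>i\<le>n. c i * s ^ i)"
    using P(1) unfolding real_polynomial_function_iff_sum by blast
  \<comment> \<open>The antiderivative of \<open>P\<close>, taken termwise.\<close>
  define Q where "Q s = (\<Sum>i\<le>n. c i / real (Suc i) * s ^ Suc i)" for s
  have Q: "(Q has_real_derivative P s) (at s)" for s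
  proof -
    have "((\<lambda>s. c i / real (Suc i) * s ^ Suc i) has_real_derivative c i * s ^ i) (at s)" for i
    proof -
      have "((\<lambda>s. c i / real (Suc i) * s ^ Suc i) has_real_derivative
          c i / real (Suc i) * (real (Suc i) * s ^ i)) (at s)"
        using DERIV_pow[of "Suc i" s] by (intro DERIV_cmult) simp
      then show ?thesis by (simp del: of_nat_Suc)
    qed
    then show ?thesis unfolding Q_def c by (intro DERIV_sum)
  qed
  \<comment> \<open>Since \<open>exp 0 = 1\<close>, the constant gives
    \<open>r 0 = \<phi> 0\<close>. The values of the difference are then at most
    \<open>K * T\<close> on the interval, by its Lipschitz bound from 0.\<close>
  define r where "r t = \<phi> 0 - Q 1 + Q (exp t)" for t
  have lip: "\<bar>(\<phi> x - r x) - (\<phi> y - r y)\<bar> \<le> K * norm (x - y)" if "x \<in> {-T..T}" "y \<in> {-T..T}" for x y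
  proof -
    have "norm ((\<phi> x - r x) - (\<phi> y - r y)) \<le> K * norm (x - y)"
    proof (rule field_differentiable_bound[OF convex_closed_interval[of "-T" T]])
      fix t assume t: "t \<in> {-T..T}"
      have "((\<lambda>t. \<phi> t - r t) has_real_derivative (\<phi>' t - P (exp t) * exp t)) (at t)"
        unfolding r_def using DERIV_chain2[OF Q DERIV_exp] deriv
        by (auto intro!: derivative_eq_intros)
      then show "((\<lambda>t. \<phi> t - r t) has_real_derivative (\<phi>' t - P (exp t) * exp t)) (at t within {-T..T})"
        by (rule has_field_derivative_at_within)
      have "\<phi>' t - P (exp t) * exp t = (\<phi>' t / exp t - P (exp t)) * exp t"
        by (simp add: left_diff_distrib)
      moreover have "\<bar>\<phi>' t / exp t - P (exp t)\<bar> \<le> K / exp T" using P(2)[of "exp t"] t by auto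
      then have "\<bar>\<phi>' t / exp t - P (exp t)\<bar> * exp t \<le> K / exp T * exp T"
        using t K by (intro mult_mono) auto
      ultimately show "norm (\<phi>' t - P (exp t) * exp t) \<le> K" by (simp add: abs_mult)
    qed (use that in auto)
    then show ?thesis by simp
  qed
  have "lip_bounded {-T..T} e (\<lambda>t. \<phi> t - r t)"
  proof (rule lip_boundedI)
    fix x assume x: "x \<in> {-T..T}"
    then have "\<bar>\<phi> x - r x\<bar> \<le> K * \<bar>x\<bar>"
      using lip[of x 0] by (simp add: r_def)
    also have "\<dots> \<le> K * T" using x K by (intro mult_left_mono) auto
    finally show "\<bar>\<phi> x - r x\<bar> \<le> e" using K by linarith
  next
    fix x y assume "x \<in> {-T..T}" "y \<in> {-T..T}"
    then have "\<bar>(\<phi> x - r x) - (\<phi> y - r y)\<bar> \<le> K * norm (x - y)" by (rule lip)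
    also have "\<dots> \<le> e * norm (x - y)" using K by (intro mult_right_mono) auto
    finally show "\<bar>(\<phi> x - r x) - (\<phi> y - r y)\<bar> \<le> e * norm (x - y)" .
  qed
  moreover have "(\<lambda>x. r (w \<bullet> x)) \<in> exp_sums"
    unfolding r_def Q_def
    by (intro exp_sums_add exp_sums_const exp_sums_sum exp_sums_cmult exp_sums_power exp_sums_exp
        finite_atMost)
  ultimately show "\<exists>r. (\<lambda>x. r (w \<bullet> x)) \<in> exp_sums \<and>
      lip_bounded {- (norm w * R)..norm w * R} e (\<lambda>t. \<phi> t - r t)"
    unfolding T_def by blast
qed

lemma approximable_exp_sums_const: "approximable B exp_sums (\<lambda>x. c)"
  by (intro approximable_self exp_sums_const)

lemma approximable_exp_sums_add:
  assumes "approximable B exp_sums f" "approximable B exp_sums g"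
  shows "approximable B exp_sums (\<lambda>x. f x + g x)"
  using assms exp_sums_add by (rule approximable_add)

lemma approximable_exp_sums_mult:
  assumes "approximable (ball 0 R) exp_sums f" "approximable (ball 0 R) exp_sums g"
  shows "approximable (ball 0 R) exp_sums (\<lambda>x. f x * g x)"
  using assms exp_sums_lip_bounded exp_sums_mult by (rule approximable_mult)

lemma approximable_exp_sums_sum:
  assumes "finite I" "\<And>i. i \<in> I \<Longrightarrow> approximable B exp_sums (f i)"
  shows "approximable B exp_sums (\<lambda>x. \<Sum>i\<in>I. f i x)"
  using assms
  by (induction I rule: finite_induct)
     (simp_all add: approximable_exp_sums_const approximable_exp_sums_add)

lemma approximable_exp_sums_prod:
  assumes "finite I" "\<And>i. i \<in> I \<Longrightarrow> approximable (ball 0 R) exp_sums (f i)"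
  shows "approximable (ball 0 R) exp_sums (\<lambda>x. \<Prod>i\<in>I. f i x)"
  using assms
  by (induction I rule: finite_induct)
     (simp_all add: approximable_exp_sums_const approximable_exp_sums_mult)

subsection \<open>A partition of unity of class \<open>C\<^sup>1\<close>\<close>

text \<open>The spline rising from 0 to 1 on the unit interval whose second derivative is 4 and then -4. Since
  \<open>bump t = C1_step (t + 1) - C1_step t\<close>, the sum of integer translates of \<open>bump\<close> telescopes.\<close>

definition C1_step :: "real \<Rightarrow> real" where
  "C1_step t = 2 * (max t 0)\<^sup>2 - 4 * (max (t - 1/2) 0)\<^sup>2 + 2 * (max (t - 1) 0)\<^sup>2"

text \<open>The hat function on the unit interval with peak 2 at 1/2.\<close>

definition C1_step' :: "real \<Rightarrow> real" where
  "C1_step' t = 4 * max t 0 - 8 * max (t - 1/2) 0 + 4 * max (t - 1) 0"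

definition bump :: "real \<Rightarrow> real" where
  "bump t = C1_step (t + 1) - C1_step t"

definition bump' :: "real \<Rightarrow> real" where
  "bump' t = C1_step' (t + 1) - C1_step' t"

lemma DERIV_max_0_power2: "((\<lambda>t. (max t 0)\<^sup>2) has_real_derivative 2 * max t 0) (at t)"
proof -
  consider "t > 0" | "t < 0" | "t = 0" by linarith
  then show ?thesis
  proof cases
    case 1
    have "((\<lambda>t. t\<^sup>2) has_real_derivative 2 * max t 0) (at t)"
      using 1 by (auto intro!: derivative_eq_intros)
    then show ?thesis
      by (rule has_field_derivative_transform_within_open[of _ _ _ "{0<..}"]) (use 1 in auto)
  next
    case 2
    have "((\<lambda>t. 0) has_real_derivative 2 * max t 0) (at t)"
      using 2 by (auto intro!: derivative_eq_intros)
    then show ?thesis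
      by (rule has_field_derivative_transform_within_open[of _ _ _ "{..<0}"]) (use 2 in auto)
  next
    case 3
    \<comment> \<open>At the kink, Caratheodory's criterion applies: the increment is
      \<open>z - 0\<close> times a continuous factor that vanishes at 0.\<close>
    have "(max z 0)\<^sup>2 - (max 0 0)\<^sup>2 = max z 0 * (z - 0)" for z :: real
      by (simp add: max_def power2_eq_square)
    moreover have "isCont (\<lambda>z :: real. max z 0) 0" by (intro continuous_intros)
    ultimately have "\<exists>g. (\<forall>z. (max z 0)\<^sup>2 - (max 0 0)\<^sup>2 = g z * (z - 0)) \<and> isCont g 0 \<and> g 0 = 2 * max 0 (0::real)"
      by (intro exI[of _ "\<lambda>z. max z 0"]) auto
    then show ?thesis unfolding 3 CARAT_DERIV .
  qed
qed

lemma DERIV_C1_step: "(C1_step has_real_derivative C1_step' t) (at t)"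
proof -
  have "((\<lambda>t. (max (t - a) 0)\<^sup>2) has_real_derivative 2 * max (t - a) 0) (at t)" for a
    using DERIV_max_0_power2[of "t - a"] DERIV_shift[of "\<lambda>t. (max t 0)\<^sup>2" _ t "- a"] by simp
  from this[of "1/2"] this[of 1] DERIV_max_0_power2[of t]
  have "((\<lambda>t. 2 * (max t 0)\<^sup>2 - 4 * (max (t - 1/2) 0)\<^sup>2 + 2 * (max (t - 1) 0)\<^sup>2) has_real_derivative
      2 * (2 * max t 0) - 4 * (2 * max (t - 1/2) 0) + 2 * (2 * max (t - 1) 0)) (at t)"
    by (intro DERIV_add DERIV_diff DERIV_cmult)
  then show ?thesis unfolding C1_step_def[abs_def] C1_step'_def by simp
qed

lemma C1_step_eq_0: "t \<le> 0 \<Longrightarrow> C1_step t = 0"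
  by (simp add: C1_step_def max_def)

lemma C1_step_eq_1: "1 \<le> t \<Longrightarrow> C1_step t = 1"
  by (simp add: C1_step_def max_def power2_eq_square algebra_simps)

text \<open>The rise consists of two parabolic arcs, \<open>2 * t\<^sup>2\<close> and
  \<open>1 - 2 * (1 - t)\<^sup>2\<close>, which meet at height 1/2.\<close>

lemma C1_step_bounds: "0 \<le> C1_step t" "C1_step t \<le> 1"
proof -
  consider "t \<le> 0" | "0 < t" "t \<le> 1/2" | "1/2 < t" "t \<le> 1" | "1 < t" by linarith
  then have "0 \<le> C1_step t \<and> C1_step t \<le> 1"
  proof cases
    case 2
    then have "C1_step t = 2 * t\<^sup>2" by (simp add: C1_step_def max_def)
    moreover have "t\<^sup>2 \<le> (1/2)\<^sup>2" using 2 by (intro power_mono) auto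
    ultimately show ?thesis by (simp add: power2_eq_square)
  next
    case 3
    then have "C1_step t = 1 - 2 * (1 - t)\<^sup>2"
      by (simp add: C1_step_def max_def power2_eq_square algebra_simps)
    moreover have "(1 - t)\<^sup>2 \<le> (1/2)\<^sup>2" using 3 by (intro power_mono) auto
    ultimately show ?thesis by (simp add: power2_eq_square)
  qed (auto simp: C1_step_eq_0 C1_step_eq_1)
  then show "0 \<le> C1_step t" "C1_step t \<le> 1" by auto
qed

lemma C1_step'_bounds: "0 \<le> C1_step' t" "C1_step' t \<le> 2"
  by (auto simp: C1_step'_def max_def)

lemma C1_step'_eq_0: "t \<le> 0 \<or> 1 \<le> t \<Longrightarrow> C1_step' t = 0"
  by (auto simp: C1_step'_def max_def)

lemma DERIV_bump: "(bump has_real_derivative bump' t) (at t)"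
proof -
  have "((\<lambda>t. C1_step (t + 1)) has_real_derivative C1_step' (t + 1)) (at t)"
    using DERIV_C1_step[of "t + 1"] by (simp add: DERIV_shift)
  then show ?thesis
    unfolding bump_def[abs_def] bump'_def using DERIV_C1_step by (intro DERIV_diff)
qed

lemma continuous_on_bump': "continuous_on A bump'"
  unfolding bump'_def[abs_def] C1_step'_def by (intro continuous_intros)

lemma abs_bump_le: "\<bar>bump t\<bar> \<le> 1"
  using C1_step_bounds[of t] C1_step_bounds[of "t + 1"] by (simp add: bump_def abs_le_iff)

lemma abs_bump'_le: "\<bar>bump' t\<bar> \<le> 2"
  using C1_step'_bounds[of t] C1_step'_bounds[of "t + 1"] by (simp add: bump'_def abs_le_iff)

lemma bump_eq_0: "1 \<le> \<bar>t\<bar> \<Longrightarrow> bump t = 0"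
  by (cases "t \<ge> 0") (auto simp: bump_def C1_step_eq_0 C1_step_eq_1)

lemma bump'_eq_0: "1 \<le> \<bar>t\<bar> \<Longrightarrow> bump' t = 0"
  by (cases "t \<ge> 0") (auto simp: bump'_def C1_step'_eq_0)

text \<open>After telescoping, the hypotheses say that the first step has already reached 1 and the
  last one has not started.\<close>

lemma sum_bump:
  assumes "0 \<le> t" "t + 1 \<le> real N"
  shows "(\<Sum>m<N. bump (t - real m)) = 1"
proof -
  have "(\<Sum>m<N. bump (t - real m)) =
      (\<Sum>m<N. C1_step (t + 1 - real m) - C1_step (t + 1 - real (Suc m)))"
    by (intro sum.cong) (auto simp: bump_def algebra_simps)
  also have "\<dots> = C1_step (t + 1) - C1_step (t + 1 - real N)"
    by (subst sum_lessThan_telescope') simp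
  also have "\<dots> = 1" using assms by (simp add: C1_step_eq_0 C1_step_eq_1)
  finally show ?thesis .
qed

section \<open>Tensor product bumps on a grid\<close>

definition grid_bump :: "real \<Rightarrow> real \<Rightarrow> ('d::finite \<Rightarrow> nat) \<Rightarrow> real ^ 'd \<Rightarrow> real" where
  "grid_bump h R k x = (\<Prod>j\<in>UNIV. bump ((x $ j + R) / h - real (k j)))"

definition grid_bump_gradient :: "real \<Rightarrow> real \<Rightarrow> ('d::finite \<Rightarrow> nat) \<Rightarrow> real ^ 'd \<Rightarrow> real ^ 'd" where
  "grid_bump_gradient h R k x = (\<chi> j. bump' ((x $ j + R) / h - real (k j)) / h *
     (\<Prod>i\<in>UNIV - {j}. bump ((x $ i + R) / h - real (k i))))"

text \<open>The grid is shifted by \<open>- R\<close>, so that natural number indices cover the cube of radius \<open>R\<close>.\<close>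

definition grid_point :: "real \<Rightarrow> real \<Rightarrow> ('d::finite \<Rightarrow> nat) \<Rightarrow> real ^ 'd" where
  "grid_point h R k = (\<chi> j. h * real (k j) - R)"

lemma GDERIV_grid_bump:
  assumes "h > 0"
  shows "GDERIV (grid_bump h R k) x :> grid_bump_gradient h R k x"
proof -
  have "((\<lambda>x. bump ((x $ j + R) / h - real (k j))) has_derivative
      (\<lambda>v. v $ j / h * bump' ((x $ j + R) / h - real (k j)))) (at x)" for j
  proof -
    have "((\<lambda>x. (x $ j + R) / h - real (k j)) has_derivative (\<lambda>v. v $ j / h)) (at x)"
      using assms by (auto intro!: derivative_eq_intros bounded_linear_imp_has_derivative)
    then show ?thesis by (rule DERIV_compose_FDERIV[OF DERIV_bump])
  qed
  then have "(grid_bump h R k has_derivative (\<lambda>v. \<Sum>j\<in>UNIV.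
      v $ j / h * bump' ((x $ j + R) / h - real (k j)) *
        (\<Prod>i\<in>UNIV - {j}. bump ((x $ i + R) / h - real (k i))))) (at x)"
    unfolding grid_bump_def[abs_def] by (intro has_derivative_prod)
  then show ?thesis
    by (simp add: gderiv_def inner_vec_def grid_bump_gradient_def mult.assoc)
qed

lemma abs_grid_bump_le: "\<bar>grid_bump h R k x\<bar> \<le> 1"
  unfolding grid_bump_def abs_prod by (intro prod_le_1) (simp add: abs_bump_le)

lemma norm_grid_bump_gradient_le:
  fixes x :: "real ^ 'd"
  assumes "h > 0"
  shows "norm (grid_bump_gradient h R k x) \<le> 2 * real CARD('d) / h"
proof -
  have "\<bar>grid_bump_gradient h R k x $ j\<bar> \<le> 2 / h" for j
  proof -
    have "\<bar>\<Prod>i\<in>UNIV - {j}. bump ((x $ i + R) / h - real (k i))\<bar> \<le> 1"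
      unfolding abs_prod by (intro prod_le_1) (simp add: abs_bump_le)
    moreover have "\<bar>bump' ((x $ j + R) / h - real (k j)) / h\<bar> \<le> 2 / h"
      using assms abs_bump'_le by (simp add: divide_right_mono)
    ultimately have "\<bar>grid_bump_gradient h R k x $ j\<bar> \<le> 2 / h * 1"
      using assms unfolding grid_bump_gradient_def vec_lambda_beta abs_mult by (intro mult_mono) auto
    then show ?thesis by simp
  qed
  then have "(\<Sum>j\<in>UNIV. \<bar>grid_bump_gradient h R k x $ j\<bar>) \<le> (\<Sum>j\<in>(UNIV :: 'd set). 2 / h)"
    by (intro sum_mono)
  then show ?thesis using norm_le_l1_cart[of "grid_bump_gradient h R k x"]
    by (simp add: mult.commute)
qed

text \<open>One coordinate far from the grid point suffices: its factor occurs in every gradient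
  component except the one for that coordinate, and there \<open>bump'\<close> vanishes
  instead.\<close>

lemma grid_bump_eq_0:
  assumes "1 \<le> \<bar>(x $ j + R) / h - real (k j)\<bar>"
  shows "grid_bump h R k x = 0" "grid_bump_gradient h R k x = 0"
proof -
  show "grid_bump h R k x = 0"
    unfolding grid_bump_def using bump_eq_0[OF assms] by (intro prod_zero bexI[of _ j]) auto
  have "grid_bump_gradient h R k x $ i = 0" for i
  proof (cases "i = j")
    case True
    then show ?thesis using bump'_eq_0[OF assms] by (simp add: grid_bump_gradient_def)
  next
    case False
    then have "(\<Prod>i\<in>UNIV - {i}. bump ((x $ i + R) / h - real (k i))) = 0"
      using bump_eq_0[OF assms] by (intro prod_zero bexI[of _ j]) auto
    then show ?thesis by (simp add: grid_bump_gradient_def)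
  qed
  then show "grid_bump_gradient h R k x = 0" by (simp add: vec_eq_iff)
qed

lemma sum_grid_bump:
  fixes x :: "real ^ 'd"
  assumes "h > 0" "\<And>j. \<bar>x $ j\<bar> \<le> R" "2 * R / h + 1 \<le> real N"
  shows "(\<Sum>k\<in>UNIV \<rightarrow>\<^sub>E {..<N}. grid_bump h R k x) = 1"
proof -
  have "(\<Sum>m<N. bump ((x $ j + R) / h - real m)) = 1" for j
  proof (rule sum_bump)
    have "- R \<le> x $ j" "x $ j \<le> R" using assms(2)[of j] by (auto simp: abs_le_iff)
    then show "0 \<le> (x $ j + R) / h" using assms(1) by simp
    have "(x $ j + R) / h \<le> 2 * R / h"
      using assms(1) \<open>x $ j \<le> R\<close> by (intro divide_right_mono) auto
    then show "(x $ j + R) / h + 1 \<le> real N" using assms(3) by linarith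
  qed
  then have "(\<Prod>j\<in>(UNIV :: 'd set). \<Sum>m<N. bump ((x $ j + R) / h - real m)) = 1" by simp
  \<comment> \<open>Expanding the product of the one-dimensional sums gives one term for each
    multi-index \<open>k\<close>.\<close>
  then show ?thesis unfolding grid_bump_def by (subst (asm) prod_sum_PiE) auto
qed

lemma norm_diff_grid_point_le:
  fixes x :: "real ^ 'd"
  assumes "h > 0" "\<And>j. \<bar>(x $ j + R) / h - real (k j)\<bar> < 1"
  shows "norm (x - grid_point h R k) \<le> h * real CARD('d)"
proof -
  have "\<bar>(x - grid_point h R k) $ j\<bar> \<le> h" for j
  proof -
    have "(x - grid_point h R k) $ j = h * ((x $ j + R) / h - real (k j))"
      using assms(1) by (simp add: grid_point_def field_simps)
    then show ?thesis using assms(1) assms(2)[of j] by (simp add: abs_mult)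
  qed
  then have "(\<Sum>j\<in>UNIV. \<bar>(x - grid_point h R k) $ j\<bar>) \<le> (\<Sum>j\<in>(UNIV :: 'd set). h)"
    by (intro sum_mono)
  then show ?thesis using norm_le_l1_cart[of "x - grid_point h R k"] by (simp add: mult.commute)
qed

text \<open>In each coordinate only the integer part of the rescaled coordinate and its successor
  can be within distance 1. The bound is independent of \<open>h\<close>, so refining the grid does
  not accumulate errors.\<close>

lemma card_active_grid_bumps_le:
  fixes x :: "real ^ 'd"
  assumes "h > 0" "\<And>j. \<bar>x $ j\<bar> \<le> R"
  shows "card {k \<in> UNIV \<rightarrow>\<^sub>E {..<N}. \<forall>j. \<bar>(x $ j + R) / h - real (k j)\<bar> < 1} \<le> 2 ^ CARD('d)"
    (is "card ?A \<le> _")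
proof -
  \<comment> \<open>\<open>nat\<close> truncates nothing, since \<open>x $ j + R\<close> is
    nonnegative.\<close>
  define p where "p j = nat \<lfloor>(x $ j + R) / h\<rfloor>" for j
  have "k j \<in> {p j..p j + 1}" if "\<bar>(x $ j + R) / h - real (k j)\<bar> < 1" for k :: "'d \<Rightarrow> nat" and j
  proof -
    have "0 \<le> (x $ j + R) / h" using assms(1) assms(2)[of j] by (auto simp: abs_le_iff)
    then have "0 \<le> \<lfloor>(x $ j + R) / h\<rfloor>" by simp
    then show ?thesis using that unfolding p_def by (simp; linarith)
  qed
  then have "?A \<subseteq> (\<Pi>\<^sub>E j\<in>UNIV. {p j..p j + 1})" by (auto simp: PiE_iff)
  then have "card ?A \<le> card (\<Pi>\<^sub>E j\<in>(UNIV :: 'd set). {p j..p j + 1})"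
    by (intro card_mono finite_PiE) auto
  also have "\<dots> = 2 ^ CARD('d)" by (simp add: card_PiE)
  finally show ?thesis .
qed

lemma approximable_grid_bump:
  fixes k :: "'d::finite \<Rightarrow> nat"
  assumes "h > 0" "0 \<le> R"
  shows "approximable (ball 0 R) exp_sums (grid_bump h R k)"
  unfolding grid_bump_def[abs_def]
proof (rule approximable_exp_sums_prod)
  fix j :: 'd
  define \<phi> where "\<phi> t = bump ((t + R) / h - real (k j))" for t
  define \<phi>' where "\<phi>' t = bump' ((t + R) / h - real (k j)) / h" for t
  have "(\<phi> has_real_derivative \<phi>' t) (at t)" for t
  proof -
    have "((\<lambda>t. (t + R) / h - real (k j)) has_real_derivative 1 / h) (at t)"
      using assms by (auto intro!: derivative_eq_intros)
    from DERIV_chain2[OF DERIV_bump this] show ?thesis by (simp add: \<phi>_def[abs_def] \<phi>'_def)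
  qed
  moreover have "continuous_on UNIV \<phi>'"
    unfolding \<phi>'_def
    by (intro continuous_on_divide continuous_on_compose2[OF continuous_on_bump'[of UNIV]]
        continuous_intros) (use assms in auto)
  ultimately have "approximable (ball 0 R) exp_sums (\<lambda>x. \<phi> (axis j (1 :: real) \<bullet> x))"
    using \<open>0 \<le> R\<close> by (rule approximable_C1_ridge)
  then show "approximable (ball 0 R) exp_sums (\<lambda>x. bump ((x $ j + R) / h - real (k j)))"
    by (simp add: \<phi>_def inner_axis')
qed simp

lemma approximable_affine:
  assumes "0 \<le> R"
  shows "approximable (ball 0 R) exp_sums (\<lambda>x. c + (x - y) \<bullet> w)"
proof -
  have "approximable (ball 0 R) exp_sums (\<lambda>x. w \<bullet> x)"
    using approximable_C1_ridge[of "\<lambda>t. t" "\<lambda>_. 1" R w] assms by (auto intro: derivative_intros)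
  then have "approximable (ball 0 R) exp_sums (\<lambda>x. (c - y \<bullet> w) + w \<bullet> x)"
    by (intro approximable_exp_sums_add approximable_exp_sums_const)
  moreover have "(\<lambda>x. (c - y \<bullet> w) + w \<bullet> x) = (\<lambda>x. c + (x - y) \<bullet> w)"
    by (simp add: inner_diff_left inner_commute[of w] fun_eq_iff)
  ultimately show ?thesis by metis
qed

subsection \<open>Approximation of functions of class \<open>C\<^sup>1\<close>\<close>

lemma GDERIV_sum:
  assumes "\<And>i. i \<in> I \<Longrightarrow> GDERIV (f i) x :> D i"
  shows "GDERIV (\<lambda>x. \<Sum>i\<in>I. f i x) x :> (\<Sum>i\<in>I. D i)"
  using assms unfolding gderiv_def inner_sum_right by (intro has_derivative_sum)

text \<open>The mean value inequality for \<open>g z - z \<bullet> Dg x\<close> costs one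
  \<open>\<eta>\<close>, and replacing the slope \<open>Dg x\<close> by \<open>Dg y\<close> costs
  another. Gradients are compared only with that at \<open>x\<close>, because later \<open>x\<close>
  lies in \<open>S\<close> while the grid point \<open>y\<close> need not.\<close>

lemma linearization_error_le:
  fixes g :: "'a::real_inner \<Rightarrow> real"
  assumes deriv: "\<And>z. z \<in> ball x \<delta> \<Longrightarrow> GDERIV g z :> Dg z"
    and close: "\<And>z. z \<in> ball x \<delta> \<Longrightarrow> norm (Dg z - Dg x) \<le> \<eta>"
    and y: "y \<in> ball x \<delta>"
  shows "\<bar>g y + (x - y) \<bullet> Dg y - g x\<bar> \<le> 2 * \<eta> * norm (x - y)"
proof -
  have "0 < \<delta>" using y by (metis ball_empty empty_iff not_le)
  then have x: "x \<in> ball x \<delta>" by simp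
  have "0 \<le> \<eta>" using close[OF x] by simp
  have "norm ((g x - x \<bullet> Dg x) - (g y - y \<bullet> Dg x)) \<le> \<eta> * norm (x - y)"
  proof (rule differentiable_bound[OF convex_ball _ _ x y])
    fix z assume z: "z \<in> ball x \<delta>"
    have "(g has_derivative (\<lambda>v. v \<bullet> Dg z)) (at z within ball x \<delta>)"
      using deriv[OF z] unfolding gderiv_def by (rule has_derivative_at_withinI)
    then show "((\<lambda>z. g z - z \<bullet> Dg x) has_derivative (\<lambda>v. v \<bullet> Dg z - v \<bullet> Dg x)) (at z within ball x \<delta>)"
      by (intro has_derivative_diff has_derivative_inner_left has_derivative_ident)
    show "onorm (\<lambda>v. v \<bullet> Dg z - v \<bullet> Dg x) \<le> \<eta>"
    proof (rule onorm_bound[OF \<open>0 \<le> \<eta>\<close>])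
      fix v
      have "norm (v \<bullet> (Dg z - Dg x)) \<le> norm v * norm (Dg z - Dg x)"
        by (simp add: Cauchy_Schwarz_ineq2)
      also have "\<dots> \<le> norm v * \<eta>" using close[OF z] by (intro mult_left_mono) auto
      finally show "norm (v \<bullet> Dg z - v \<bullet> Dg x) \<le> \<eta> * norm v"
        by (simp add: inner_diff_right mult.commute)
    qed
  qed
  then have 1: "\<bar>g x - g y - (x - y) \<bullet> Dg x\<bar> \<le> \<eta> * norm (x - y)"
    by (simp add: inner_diff_left algebra_simps)
  have "\<bar>(x - y) \<bullet> (Dg y - Dg x)\<bar> \<le> norm (x - y) * norm (Dg y - Dg x)"
    by (rule Cauchy_Schwarz_ineq2)
  also have "\<dots> \<le> norm (x - y) * \<eta>" using close[OF y] by (intro mult_left_mono) auto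
  finally have 2: "\<bar>(x - y) \<bullet> Dg y - (x - y) \<bullet> Dg x\<bar> \<le> \<eta> * norm (x - y)"
    by (simp add: inner_diff_right mult.commute)
  from 1 2 show ?thesis by (simp add: algebra_simps)
qed

lemma uniform_gradient_modulus:
  fixes S U :: "'a::euclidean_space set" and Dg :: "'a \<Rightarrow> 'b::real_normed_vector"
  assumes "compact S" "open U" "S \<subseteq> U" "continuous_on U Dg" "\<eta> > 0"
  obtains \<delta> where "\<delta> > 0" "\<And>x. x \<in> S \<Longrightarrow> ball x \<delta> \<subseteq> U"
    and "\<And>x z. x \<in> S \<Longrightarrow> z \<in> ball x \<delta> \<Longrightarrow> norm (Dg z - Dg x) \<le> \<eta>"
proof -
  obtain r where r: "r > 0" "(\<Union>x\<in>S. ball x r) \<subseteq> U"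
    using compact_subset_open_imp_ball_epsilon_subset[OF assms(1-3)] by blast
  \<comment> \<open>A compact thickening of \<open>S\<close> inside \<open>U\<close>: uniform
    continuity on \<open>S\<close> alone would not reach the points \<open>z\<close> outside
    \<open>S\<close>.\<close>
  define K where "K = {x + y |x y. x \<in> S \<and> y \<in> cball 0 (r / 2)}"
  have ball: "ball x (r / 2) \<subseteq> K" if "x \<in> S" for x
  proof
    fix z assume "z \<in> ball x (r / 2)"
    then have "z - x \<in> cball 0 (r / 2)" "z = x + (z - x)" by (auto simp: dist_norm norm_minus_commute)
    then show "z \<in> K" using that unfolding K_def by blast
  qed
  have "K \<subseteq> (\<Union>x\<in>S. ball x r)" using r(1) by (force simp: K_def dist_norm)
  then have "K \<subseteq> U" using r(2) by simp
  have "compact K" unfolding K_def using assms(1) by (intro compact_sums compact_cball)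
  then have "uniformly_continuous_on K Dg"
    using assms(4) \<open>K \<subseteq> U\<close> by (intro compact_uniformly_continuous) (auto intro: continuous_on_subset)
  then obtain d where d: "d > 0" "\<And>x z. x \<in> K \<Longrightarrow> z \<in> K \<Longrightarrow> dist z x < d \<Longrightarrow> dist (Dg z) (Dg x) < \<eta>"
    using \<open>\<eta> > 0\<close> unfolding uniformly_continuous_on_def by metis
  show thesis
  proof (rule that[of "min d (r / 2)"])
    show "min d (r / 2) > 0" using d r by simp
    fix x assume x: "x \<in> S"
    have sub: "ball x (min d (r / 2)) \<subseteq> K" using ball[OF x] by auto
    then show "ball x (min d (r / 2)) \<subseteq> U" using \<open>K \<subseteq> U\<close> by blast
    fix z assume z: "z \<in> ball x (min d (r / 2))"
    have "x \<in> K" using ball[OF x] r(1) centre_in_ball[of x "r / 2"] by fastforce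
    then have "dist (Dg z) (Dg x) < \<eta>"
      using d(2)[of x z] z sub by (auto simp: dist_commute)
    then show "norm (Dg z - Dg x) \<le> \<eta>" by (simp add: dist_norm)
  qed
qed

lemma C1_approx_by_exp_sums:
  fixes g :: "real ^ 'd \<Rightarrow> real"
  assumes S: "compact S" and U: "open U" "S \<subseteq> U" and R: "S \<subseteq> ball 0 R" "0 \<le> R"
    and deriv: "\<And>x. x \<in> U \<Longrightarrow> GDERIV g x :> Dg x" and cont: "continuous_on U Dg"
    and "e > 0"
  obtains G where "approximable (ball 0 R) exp_sums G"
    and "\<And>x. x \<in> S \<Longrightarrow> \<bar>g x - G x\<bar> \<le> e \<and> (\<exists>D. GDERIV G x :> D \<and> norm (Dg x - D) \<le> e)"
proof -
  define d where "d = real CARD('d)"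
  have "d \<ge> 1" by (simp add: d_def Suc_leI)
  \<comment> \<open>At most \<open>2 ^ CARD('d)\<close> bumps are active at a point. For the
    gradient, each contributes \<open>\<eta>\<close> from the slopes and
    \<open>2 * \<eta> * (h * d) * (2 * d / h) = \<eta> * (4 * d * d)\<close> from the bump gradient;
    the width \<open>h\<close> cancels.\<close>
  define \<eta> where "\<eta> = e / (2 ^ CARD('d) * (1 + 4 * d * d))"
  have "1 + 4 * d * d > 0" by (simp add: d_def add_pos_nonneg)
  then have \<eta>: "\<eta> > 0" "2 ^ CARD('d) * (\<eta> * (1 + 4 * d * d)) = e"
    using \<open>e > 0\<close> by (auto simp: \<eta>_def)
  obtain \<delta> where \<delta>: "\<delta> > 0" "\<And>x. x \<in> S \<Longrightarrow> ball x \<delta> \<subseteq> U"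
    and close: "\<And>x z. x \<in> S \<Longrightarrow> z \<in> ball x \<delta> \<Longrightarrow> norm (Dg z - Dg x) \<le> \<eta>"
    using uniform_gradient_modulus[OF S U cont \<eta>(1)] by blast
  \<comment> \<open>Active grid points lie within \<open>h * d\<close> of \<open>x\<close>, hence
    strictly inside the ball of radius \<open>\<delta>\<close>; \<open>h \<le> 1\<close> serves the
    bound on values.\<close>
  define h where "h = min 1 (\<delta> / (2 * d))"
  have h: "h > 0" "h \<le> 1" using \<delta> \<open>d \<ge> 1\<close> by (auto simp: h_def)
  have "h * d \<le> \<delta> / (2 * d) * d" using \<open>d \<ge> 1\<close> by (intro mult_right_mono) (auto simp: h_def)
  then have hd: "h * d < \<delta>" using \<delta>(1) \<open>d \<ge> 1\<close> by simp
  obtain N :: nat where N: "2 * R / h + 1 \<le> real N" using real_arch_simple by blast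
  define K :: "('d \<Rightarrow> nat) set" where "K = UNIV \<rightarrow>\<^sub>E {..<N}"
  have "finite K" unfolding K_def by (intro finite_PiE) auto
  define y where "y k = (grid_point h R k :: real ^ 'd)" for k
  \<comment> \<open>Grid points outside \<open>U\<close> give meaningless coefficients, but their
    bumps and bump gradients vanish at every point of \<open>S\<close>.\<close>
  define T where "T k x = g (y k) + (x - y k) \<bullet> Dg (y k)" for k x
  define G where "G x = (\<Sum>k\<in>K. grid_bump h R k x * T k x)" for x
  have "approximable (ball 0 R) exp_sums G"
    unfolding G_def T_def using h R(2) \<open>finite K\<close>
    by (intro approximable_exp_sums_sum approximable_exp_sums_mult approximable_grid_bump
        approximable_affine)
  moreover have "\<bar>g x - G x\<bar> \<le> e \<and> (\<exists>D. GDERIV G x :> D \<and> norm (Dg x - D) \<le> e)" if x: "x \<in> S" for x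
  proof -
    define A where "A = {k \<in> K. \<forall>j. \<bar>(x $ j + R) / h - real (k j)\<bar> < 1}"
    have "A \<subseteq> K" by (auto simp: A_def)
    have box: "\<bar>z $ j\<bar> \<le> R" if "z \<in> ball 0 R" for z :: "real ^ 'd" and j
      using that component_le_norm_cart[of z j] by simp
    have "x \<in> ball 0 R" "x \<in> U" using x R U by auto
    \<comment> \<open>The bumps sum to 1 on this ball. As the ball is open, the identity can be
      differentiated at \<open>x\<close>.\<close>
    have error: "G z - g z = (\<Sum>k\<in>K. grid_bump h R k z * (T k z - g z))" if "z \<in> ball 0 R" for z
    proof -
      have "(\<Sum>k\<in>K. grid_bump h R k z) = 1"
        unfolding K_def using h(1) box[OF that] N by (rule sum_grid_bump)
      then show ?thesis
        by (simp add: G_def right_diff_distrib sum_subtractf flip: sum_distrib_right)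
    qed
    \<comment> \<open>The product rule, where the affine \<open>T k\<close> has constant gradient
      \<open>Dg (y k)\<close>.\<close>
    define E where "E k = grid_bump h R k x *\<^sub>R (Dg (y k) - Dg x) +
      (T k x - g x) *\<^sub>R grid_bump_gradient h R k x" for k
    have "GDERIV (\<lambda>z. \<Sum>k\<in>K. grid_bump h R k z * (T k z - g z)) x :> (\<Sum>k\<in>K. E k)"
    proof (rule GDERIV_sum)
      fix k
      have "GDERIV (T k) x :> Dg (y k)"
        unfolding T_def gderiv_def by (auto intro!: derivative_eq_intros)
      then have "GDERIV (\<lambda>z. T k z - g z) x :> Dg (y k) - Dg x"
        using deriv[OF \<open>x \<in> U\<close>] by (rule GDERIV_diff)
      from GDERIV_mult[OF GDERIV_grid_bump[OF h(1)] this]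
      show "GDERIV (\<lambda>z. grid_bump h R k z * (T k z - g z)) x :> E k" by (simp add: E_def)
    qed
    then have "GDERIV (\<lambda>z. G z - g z) x :> (\<Sum>k\<in>K. E k)"
      unfolding gderiv_def
      by (rule has_derivative_transform_within_open[OF _ open_ball \<open>x \<in> ball 0 R\<close>]) (simp add: error)
    from GDERIV_add[OF this deriv[OF \<open>x \<in> U\<close>]]
    have GD: "GDERIV G x :> (\<Sum>k\<in>K. E k) + Dg x" by simp
    have inactive: "grid_bump h R k x = 0 \<and> grid_bump_gradient h R k x = 0" if "k \<in> K - A" for k
    proof -
      have "\<not> (\<forall>j. \<bar>(x $ j + R) / h - real (k j)\<bar> < 1)" using that by (simp add: A_def)
      then obtain j where "\<not> \<bar>(x $ j + R) / h - real (k j)\<bar> < 1" by blast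
      then show ?thesis using grid_bump_eq_0[of x j R h k] by (simp only: not_less simp_thms)
    qed
    have active: "\<bar>T k x - g x\<bar> \<le> 2 * \<eta> * (h * d)" "norm (Dg (y k) - Dg x) \<le> \<eta>" if "k \<in> A" for k
    proof -
      have "norm (x - y k) \<le> h * d"
        unfolding y_def d_def using that h(1) by (intro norm_diff_grid_point_le) (auto simp: A_def)
      moreover from this have ball: "y k \<in> ball x \<delta>" using hd by (simp add: dist_norm)
      have "\<bar>T k x - g x\<bar> \<le> 2 * \<eta> * norm (x - y k)"
        unfolding T_def using deriv close[OF x] \<delta>(2)[OF x] ball
        by (intro linearization_error_le[where \<delta> = \<delta>]) auto
      moreover have "2 * \<eta> * norm (x - y k) \<le> 2 * \<eta> * (h * d)"
        using calculation \<eta>(1) by (intro mult_left_mono) auto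
      ultimately show "\<bar>T k x - g x\<bar> \<le> 2 * \<eta> * (h * d)" by linarith
      show "norm (Dg (y k) - Dg x) \<le> \<eta>" using close[OF x ball] .
    qed
    have "card A \<le> 2 ^ CARD('d)"
      unfolding A_def K_def using h(1) box[OF \<open>x \<in> ball 0 R\<close>] by (rule card_active_grid_bumps_le)
    then have "real (card A) \<le> real (2 ^ CARD('d))" by (rule of_nat_mono)
    then have card: "real (card A) \<le> 2 ^ CARD('d)" by (simp only: of_nat_power of_nat_numeral)
    have total: "real (card A) * (\<eta> * (1 + 4 * d * d)) \<le> e"
      using mult_right_mono[OF card, of "\<eta> * (1 + 4 * d * d)"] \<eta> \<open>1 + 4 * d * d > 0\<close> by simp
    have "G x - g x = (\<Sum>k\<in>A. grid_bump h R k x * (T k x - g x))"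
      unfolding error[OF \<open>x \<in> ball 0 R\<close>]
      using \<open>finite K\<close> \<open>A \<subseteq> K\<close> inactive by (intro sum.mono_neutral_right) auto
    also have "\<bar>\<dots>\<bar> \<le> (\<Sum>k\<in>A. \<eta> * (1 + 4 * d * d))"
    proof (rule order_trans[OF sum_abs sum_mono])
      fix k assume "k \<in> A"
      have "\<bar>grid_bump h R k x * (T k x - g x)\<bar> \<le> 1 * (2 * \<eta> * (h * d))"
        unfolding abs_mult using abs_grid_bump_le active(1)[OF \<open>k \<in> A\<close>] by (intro mult_mono) auto
      also have "\<dots> = \<eta> * (2 * (h * d))" by simp
      also have "2 * (h * d) \<le> 2 * (1 * d)"
        using h \<open>d \<ge> 1\<close> by (intro mult_left_mono mult_right_mono) auto
      then have "2 * (h * d) \<le> 1 + 4 * d * d"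
        using mult_left_mono[OF \<open>d \<ge> 1\<close>, of d] \<open>d \<ge> 1\<close> by linarith
      then have "\<eta> * (2 * (h * d)) \<le> \<eta> * (1 + 4 * d * d)" using \<eta>(1) by (intro mult_left_mono) auto
      finally show "\<bar>grid_bump h R k x * (T k x - g x)\<bar> \<le> \<eta> * (1 + 4 * d * d)" .
    qed
    finally have "\<bar>g x - G x\<bar> \<le> e" using total by simp
    moreover have "norm (\<Sum>k\<in>K. E k) \<le> e"
    proof -
      have "(\<Sum>k\<in>K. E k) = (\<Sum>k\<in>A. E k)"
        using \<open>finite K\<close> \<open>A \<subseteq> K\<close> inactive
        by (intro sum.mono_neutral_right) (auto simp: E_def)
      also have "norm \<dots> \<le> (\<Sum>k\<in>A. \<eta> * (1 + 4 * d * d))"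
      proof (rule sum_norm_le)
        fix k assume "k \<in> A"
        have "norm (grid_bump h R k x *\<^sub>R (Dg (y k) - Dg x)) \<le> 1 * \<eta>"
          unfolding norm_scaleR using abs_grid_bump_le active(2)[OF \<open>k \<in> A\<close>] by (intro mult_mono) auto
        moreover have "norm ((T k x - g x) *\<^sub>R grid_bump_gradient h R k x)
            \<le> 2 * \<eta> * (h * d) * (2 * d / h)"
          unfolding norm_scaleR d_def using active(1)[OF \<open>k \<in> A\<close>] norm_grid_bump_gradient_le[OF h(1)] h \<eta>
          by (intro mult_mono) (auto simp: d_def)
        moreover have "2 * \<eta> * (h * d) * (2 * d / h) = \<eta> * (4 * d * d)" using h by simp
        ultimately show "norm (E k) \<le> \<eta> * (1 + 4 * d * d)"
          using norm_triangle_ineq[of "grid_bump h R k x *\<^sub>R (Dg (y k) - Dg x)"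
              "(T k x - g x) *\<^sub>R grid_bump_gradient h R k x"]
          unfolding E_def distrib_left by linarith
      qed
      finally show ?thesis using total by simp
    qed
    then have "norm (Dg x - ((\<Sum>k\<in>K. E k) + Dg x)) \<le> e" by (simp add: norm_minus_commute)
    ultimately show ?thesis using GD by blast
  qed
  ultimately show thesis by (rule that)
qed

lemma relu_network_approximates_S1:
  fixes S :: "(real ^ 'd) set"
  assumes "compact S" "C1_on S f Df" "\<epsilon> > 0"
  obtains h where "single_layer_network relu h" "approximates_S1 S \<epsilon> f Df h"
proof -
  obtain U g Dg where U: "open U" "S \<subseteq> U" and deriv: "\<And>x. x \<in> U \<Longrightarrow> GDERIV g x :> Dg x"
    and cont: "continuous_on U Dg" and f: "\<And>x. x \<in> S \<Longrightarrow> f x = g x \<and> Df x = Dg x"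
    using assms(2) unfolding C1_on_def by blast
  obtain R where R: "R > 0" "S \<subseteq> ball 0 R"
    using bounded_subset_ballD[OF compact_imp_bounded[OF assms(1)], of 0] by blast
  \<comment> \<open>Two errors of at most a third each, from \<open>g\<close> to \<open>G\<close>
    and from \<open>G\<close> to the network, leave room for the strict inequality.\<close>
  have "0 \<le> R" "\<epsilon> / 3 > 0" using R assms(3) by auto
  from C1_approx_by_exp_sums[OF assms(1) U R(2) this(1) deriv cont this(2)]
  obtain G where G: "approximable (ball 0 R) exp_sums G"
    "\<And>x. x \<in> S \<Longrightarrow> \<bar>g x - G x\<bar> \<le> \<epsilon> / 3 \<and> (\<exists>D. GDERIV G x :> D \<and> norm (Dg x - D) \<le> \<epsilon> / 3)"
    by blast
  have "approximable (ball 0 R) {h. single_layer_network relu h} G"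
    using G(1) exp_sums_approximable_by_networks[OF _ \<open>0 \<le> R\<close>] by (rule approximable_trans)
  then obtain h where h: "single_layer_network relu h" "lip_bounded (ball 0 R) (\<epsilon> / 3) (\<lambda>x. G x - h x)"
    using \<open>\<epsilon> / 3 > 0\<close> unfolding approximable_def by blast
  have "\<bar>f x - h x\<bar> < \<epsilon>" if "x \<in> S" for x
  proof -
    have "\<bar>G x - h x\<bar> \<le> \<epsilon> / 3" using h(2) R(2) that by (auto simp: lip_bounded_def)
    moreover have "\<bar>g x - G x\<bar> \<le> \<epsilon> / 3" using G(2)[OF that] by blast
    ultimately show ?thesis using f[OF that] assms(3) by arith
  qed
  moreover have "norm (Df x - D) < \<epsilon>" if x: "x \<in> S" and D: "GDERIV h x :> D" for x D
  proof -
    obtain D' where D': "GDERIV G x :> D'" "norm (Dg x - D') \<le> \<epsilon> / 3" using G(2)[OF x] by blast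
    \<comment> \<open>\<open>G\<close> is differentiable at \<open>x\<close>, so wherever
      \<open>h\<close> has a gradient, so does the Lipschitz-small \<open>G - h\<close>.\<close>
    have "norm (D' - D) \<le> \<epsilon> / 3"
      using lip_bounded_gradient_le[OF open_ball _ h(2) GDERIV_diff[OF D'(1) D]] R(2) x by blast
    then have "norm ((Dg x - D') + (D' - D)) \<le> \<epsilon> / 3 + \<epsilon> / 3"
      using D'(2) by (intro norm_triangle_mono)
    then show ?thesis using f[OF x] assms(3) by simp
  qed
  ultimately have "approximates_S1 S \<epsilon> f Df h"
    unfolding approximates_S1_def using null_set_not_differentiable_relu_network[OF h(1)] by blast
  with h(1) show thesis by (rule that)
qed

theorem theorem1:
  fixes S :: "(real ^ 'd) set"
    and f :: "real ^ 'd \<Rightarrow> real"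
    and Df :: "real ^ 'd \<Rightarrow> real ^ 'd"
  assumes "compact S"
    and "C1_on S f Df"
  shows "(\<forall>\<epsilon>>0. \<exists>h. single_layer_network relu h \<and> approximates_S1 S \<epsilon> f Df h) \<and>
         (\<forall>a. 0 < a \<and> a < 1 \<longrightarrow>
            (\<forall>\<epsilon>>0. \<exists>h. single_layer_network (leaky_relu a) h \<and> approximates_S1 S \<epsilon> f Df h))"
  \<comment> \<open>The leaky network is the same function \<open>h\<close>, so its approximation
    property carries over unchanged.\<close>
  using relu_network_approximates_S1[OF assms] single_layer_network_leaky_relu by metis

end
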